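(* Let $\mathcal{S}$ be a trajectory set satisfying both (TC$_{\text{bad}}$) and (P$_{\text{bad}}$), and suppose that $(S,0)$ is a good node. Then $(K)$-a.e. holds.
   Context: Fix $s_0\in\mathbb{R}$. A trajectory set $\mathcal{S}$ is a set of real sequences $S=(S_i)_{i\ge 0}$ with $S_0=s_0$. For $S\in\mathcal{S}$ and an integer $j\ge 0$, the node $(S,j)$ stands for $\mathcal{S}_{(S,j)}=\{\tilde S\in\mathcal{S}:\tilde S_i=S_i,\ 0\le i\le j\}$ (so the node $(S,0)$ is the same, namely all of $\mathcal{S}$, for every $S\in\mathcal{S}$). $\mathcal{H}_{(S,j)}$ is the set of sequences $H=(H_i)_{i\ge j}$ of functions $H_i:\mathcal{S}_{(S,j)}\to\mathbb{R}$ that are non-anticipative: $H_i(\tilde S)=H_i(\hat S)$ whenever $\tilde S_k=\hat S_k$ for $j\le k\le i$. For $V\in\mathbb{R}$, $H\in\mathcal{H}_{(S,j)}$, $n\ge j$, put $\Pi^{V,H}_{j,n}(\tilde S)=V+\sum_{i=j}^{n-1}H_i(\tilde S)(\tilde S_{i+1}-\tilde S_i)$ for $\tilde S\in\mathcal{S}_{(S,j)}$. $\mathcal{E}_{(S,j)}$ is the set of all such functions $\Pi^{V,H}_{j,n}$, and $\mathcal{E}^+_{(S,j)}$ the set of its non-negative elements. $P$ is the set of all functions $\mathcal{S}\to[0,\infty]$. Conventions: $0\cdot\infty=0$, $\inf\emptyset=\infty$. For $f\in P$, $\overline{I}_jf(S)=\inf\sum_{m\ge1}V^m$ over all $f_m=\liminf_{n\to\infty}\Pi^{V^m,H^m}_{j,n}$,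 $m\ge1$, with $\Pi^{V^m,H^m}_{j,n}\in\mathcal{E}^+_{(S,j)}$ for all $n\ge j$, such that $f\le\sum_{m\ge1}f_m$ on $\mathcal{S}_{(S,j)}$. This depends only on $f|_{\mathcal{S}_{(S,j)}}$, so it also makes sense for functions defined on $\mathcal{S}_{(S,j)}$ only. $\overline{I}f:=\overline{I}_0f$ does not depend on $S$. A set $E\subseteq\mathcal{S}$ is null if $\overline{I}(\mathbf{1}_E)=0$; a property holds a.e. if it holds off a null set. Property $(K_{(S,j)})$: for every $n\ge0$ and all $f_0=\Pi^{V^0,H^0}_{j,n_0}\in\mathcal{E}_{(S,j)}$ and $f_m=\liminf_{k\to\infty}\Pi^{V^m,H^m}_{j,k}$ with $\Pi^{V^m,H^m}_{j,k}\in\mathcal{E}^+_{(S,j)}$ for all $k\ge j$, $1\le m\le n$, the function $g_n=\sum_{m=0}^nf_m$ satisfies $\overline{I}_jg_n^+(S)\le V^0+\dots+V^n+\overline{I}_jg_n^-(S)$, where $g^+=\max(g,0)$, $g^-=\max(-g,0)$. $(K)$-a.e. means: for each $j\ge0$, $(K_{(S,j)})$ holds for a.e. $S\in\mathcal{S}$. Node types: $(S,j)$ is an up-down node if $\sup_{\tilde S\in\mathcal{S}_{(S,j)}}(\tilde S_{j+1}-S_j)>0$ and $\inf_{\tilde S\in\mathcal{S}_{(S,j)}}(\tilde S_{j+1}-S_j)<0$; it is a flat node if this supremum and this infimum are both $0$; it is an arbitrage node if it is neither up-down nor flat. A node $(S,j)$ is bad if for every $\tilde S\in\mathcal{S}_{(S,j)}$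 there is $k\ge j$ such that $(\tilde S,k)$ is an arbitrage node and $\tilde S_{k+1}\ne\tilde S_k$; otherwise it is good. (TC$_{\text{bad}}$): if $(S^n)_{n\ge0}$ is a sequence in $\mathcal{S}$ with $S^n_i=S^{n+1}_i$ for all $0\le i\le n$ and all $n\geq 0$, and if there is $n_0\ge0$ such that $(S^n,n)$ is a good node for every $n\ge n_0$, then the sequence $\overline{S}=(\overline{S}_i)_{i\ge0}$, $\overline{S}_i=S^i_i$, belongs to $\mathcal{S}$. (P$_{\text{bad}}$): whenever $(S,k)$ is a good up-down node such that $(S,k+1)$ is bad, there are $S^1,S^2\in\mathcal{S}_{(S,k)}$ such that $S^1_{k+1}>S_{k+1}>S^2_{k+1}$ and $(S^n,k+1)$ is good for $n=1,2$. *)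

theory Defs
  imports Complex_Main "HOL-Library.Extended_Real" "HOL-Library.Liminf_Limsup"
    "HOL-Library.Indicator_Function"
begin

type_synonym trajectory = "nat \<Rightarrow> real"

definition trajectory_set :: "real \<Rightarrow> trajectory set \<Rightarrow> bool" where
  "trajectory_set s0 \<S> \<longleftrightarrow> (\<forall>S\<in>\<S>. S 0 = s0)"

definition node :: "trajectory set \<Rightarrow> trajectory \<Rightarrow> nat \<Rightarrow> trajectory set" where
  "node \<S> S j = {T\<in>\<S>. \<forall>i\<le>j. T i = S i}"

text \<open>A strategy at the node \<open>(S,j)\<close> is a total function here; only its values \<open>H i T\<close> with
  \<open>i \<ge> j\<close> and \<open>T\<close> in the node are constrained, and only those are used below.\<close>

definition strategies ::
    "trajectory set \<Rightarrow> trajectory \<Rightarrow> nat \<Rightarrow> (nat \<Rightarrow> trajectory \<Rightarrow> real) set" where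
  "strategies \<S> S j =
     {H. \<forall>i\<ge>j. \<forall>T\<in>node \<S> S j. \<forall>U\<in>node \<S> S j.
           (\<forall>k. j \<le> k \<and> k \<le> i \<longrightarrow> T k = U k) \<longrightarrow> H i T = H i U}"

definition portfolio ::
    "nat \<Rightarrow> real \<Rightarrow> (nat \<Rightarrow> trajectory \<Rightarrow> real) \<Rightarrow> nat \<Rightarrow> trajectory \<Rightarrow> real" where
  "portfolio j V H n T = V + (\<Sum>i=j..<n. H i T * (T (Suc i) - T i))"

text \<open>All portfolio values \<open>portfolio j V H n\<close>, \<open>n \<ge> j\<close>, are non-negative elementary functions
  on the node \<open>(S,j)\<close>.\<close>

definition nonneg_portfolio ::
    "trajectory set \<Rightarrow> trajectory \<Rightarrow> nat \<Rightarrow> real \<Rightarrow> (nat \<Rightarrow> trajectory \<Rightarrow> real) \<Rightarrow> bool" where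
  "nonneg_portfolio \<S> S j V H \<longleftrightarrow>
     H \<in> strategies \<S> S j \<and> (\<forall>n\<ge>j. \<forall>T\<in>node \<S> S j. 0 \<le> portfolio j V H n T)"

definition limit_portfolio ::
    "nat \<Rightarrow> real \<Rightarrow> (nat \<Rightarrow> trajectory \<Rightarrow> real) \<Rightarrow> trajectory \<Rightarrow> ereal" where
  "limit_portfolio j V H T = liminf (\<lambda>n. ereal (portfolio j V H n T))"

text \<open>The superhedging functional is meant for functions with values in \<open>[0,\<infinity>]\<close>. The countable
  family is indexed from 0. All terms of both series are non-negative, so \<open>suminf\<close> is the sum in
  \<open>[0,\<infinity>]\<close>; the infimum of the empty set is \<open>\<infinity>\<close>.\<close>

definition superhedge ::
    "trajectory set \<Rightarrow> nat \<Rightarrow> (trajectory \<Rightarrow> ereal) \<Rightarrow> trajectory \<Rightarrow> ereal" where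
  "superhedge \<S> j f S =
     Inf {(\<Sum>m. ereal (V m)) | V H.
            (\<forall>m. nonneg_portfolio \<S> S j (V m) (H m)) \<and>
            (\<forall>T\<in>node \<S> S j. f T \<le> (\<Sum>m. limit_portfolio j (V m) (H m) T))}"

lemma superhedge_0_indep:
  assumes "trajectory_set s0 \<S>" "S \<in> \<S>" "S' \<in> \<S>"
  shows "superhedge \<S> 0 f S = superhedge \<S> 0 f S'"
proof -
  have "node \<S> S 0 = node \<S> S' 0"
    using assms unfolding node_def trajectory_set_def by (metis le_zero_eq)
  thus ?thesis
    by (simp add: superhedge_def nonneg_portfolio_def strategies_def)
qed

text \<open>By the preceding lemma the choice of \<open>S\<close> is immaterial.\<close>

definition null_set :: "trajectory set \<Rightarrow> trajectory set \<Rightarrow> bool" where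
  "null_set \<S> E \<longleftrightarrow> E \<subseteq> \<S> \<and> (\<forall>S\<in>\<S>. superhedge \<S> 0 (indicator E) S = 0)"

definition almost_everywhere :: "trajectory set \<Rightarrow> (trajectory \<Rightarrow> bool) \<Rightarrow> bool" where
  "almost_everywhere \<S> Q \<longleftrightarrow> (\<exists>N. null_set \<S> N \<and> (\<forall>S\<in>\<S> - N. Q S))"

definition property_K :: "trajectory set \<Rightarrow> trajectory \<Rightarrow> nat \<Rightarrow> bool" where
  "property_K \<S> S j \<longleftrightarrow>
     (\<forall>n n0 (V :: nat \<Rightarrow> real) H.
        j \<le> n0 \<longrightarrow> H 0 \<in> strategies \<S> S j \<longrightarrow>
        (\<forall>m\<in>{1..n}. nonneg_portfolio \<S> S j (V m) (H m)) \<longrightarrow>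
        (let g = (\<lambda>T. ereal (portfolio j (V 0) (H 0) n0 T)
                      + (\<Sum>m=1..n. limit_portfolio j (V m) (H m) T))
         in superhedge \<S> j (\<lambda>T. max (g T) 0) S
              \<le> ereal (\<Sum>m=0..n. V m) + superhedge \<S> j (\<lambda>T. max (- g T) 0) S))"

definition K_ae :: "trajectory set \<Rightarrow> bool" where
  "K_ae \<S> \<longleftrightarrow> (\<forall>j. almost_everywhere \<S> (\<lambda>S. property_K \<S> S j))"

text \<open>Increments at a node may be unbounded, so suprema and infima are taken in the extended
  reals.\<close>

definition sup_increment :: "trajectory set \<Rightarrow> trajectory \<Rightarrow> nat \<Rightarrow> ereal" where
  "sup_increment \<S> S j = (SUP T\<in>node \<S> S j. ereal (T (Suc j) - S j))"

definition inf_increment :: "trajectory set \<Rightarrow> trajectory \<Rightarrow> nat \<Rightarrow> ereal" where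
  "inf_increment \<S> S j = (INF T\<in>node \<S> S j. ereal (T (Suc j) - S j))"

definition up_down_node :: "trajectory set \<Rightarrow> trajectory \<Rightarrow> nat \<Rightarrow> bool" where
  "up_down_node \<S> S j \<longleftrightarrow> sup_increment \<S> S j > 0 \<and> inf_increment \<S> S j < 0"

definition flat_node :: "trajectory set \<Rightarrow> trajectory \<Rightarrow> nat \<Rightarrow> bool" where
  "flat_node \<S> S j \<longleftrightarrow> sup_increment \<S> S j = 0 \<and> inf_increment \<S> S j = 0"

definition arbitrage_node :: "trajectory set \<Rightarrow> trajectory \<Rightarrow> nat \<Rightarrow> bool" where
  "arbitrage_node \<S> S j \<longleftrightarrow> \<not> up_down_node \<S> S j \<and> \<not> flat_node \<S> S j"

definition bad_node :: "trajectory set \<Rightarrow> trajectory \<Rightarrow> nat \<Rightarrow> bool" where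
  "bad_node \<S> S j \<longleftrightarrow>
     (\<forall>T\<in>node \<S> S j. \<exists>k\<ge>j. arbitrage_node \<S> T k \<and> T (Suc k) \<noteq> T k)"

abbreviation good_node :: "trajectory set \<Rightarrow> trajectory \<Rightarrow> nat \<Rightarrow> bool" where
  "good_node \<S> S j \<equiv> \<not> bad_node \<S> S j"

definition TC_bad :: "trajectory set \<Rightarrow> bool" where
  "TC_bad \<S> \<longleftrightarrow>
     (\<forall>X :: nat \<Rightarrow> trajectory.
        (\<forall>n. X n \<in> \<S>) \<longrightarrow> (\<forall>n. \<forall>i\<le>n. X n i = X (Suc n) i) \<longrightarrow>
        (\<exists>n0. \<forall>n\<ge>n0. good_node \<S> (X n) n) \<longrightarrow> (\<lambda>i. X i i) \<in> \<S>)"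

definition P_bad :: "trajectory set \<Rightarrow> bool" where
  "P_bad \<S> \<longleftrightarrow>
     (\<forall>S\<in>\<S>. \<forall>k. good_node \<S> S k \<longrightarrow> up_down_node \<S> S k \<longrightarrow> bad_node \<S> S (Suc k) \<longrightarrow>
        (\<exists>S1\<in>node \<S> S k. \<exists>S2\<in>node \<S> S k.
           S1 (Suc k) > S (Suc k) \<and> S (Suc k) > S2 (Suc k) \<and>
           good_node \<S> S1 (Suc k) \<and> good_node \<S> S2 (Suc k)))"

end

theory Submission
  imports Defs
begin

text \<open>Betting on the sure direction at every arbitrage node costs nothing, and countably many copies
  of this bet pay \<open>\<infinity>\<close> as soon as the trajectory moves at such a node; so these trajectories form a
  null set, and it contains every trajectory through a bad node. At a good node, adding to \<open>g\<close> a
  superhedge of its negative part reduces property K to the following claim: if an elementary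
  function plus countably many limits of non-negative portfolios is non-negative, it is superhedged
  at the sum of the initial capitals. At an up-down node non-negativity bounds the individual
  positions by the portfolio values, so the positions can be summed into a single strategy there; it
  stops trading at the first arbitrage move or bad node. Its value stays non-negative: at a good node
  a negative total could be carried forward, without ever increasing, along good nodes to a
  trajectory in \<open>\<S>\<close> that contradicts the assumption by Fatou's lemma, and \<open>P_bad\<close> covers the first step
  into a bad node.\<close>

section \<open>Series and lower limits\<close>

lemma sum_liminf_le_liminf_sum:
  fixes u :: "nat \<Rightarrow> nat \<Rightarrow> real"
  assumes "\<And>k n. 0 \<le> u k n"
  shows "(\<Sum>k<K. liminf (\<lambda>n. ereal (u k n))) \<le> liminf (\<lambda>n. ereal (\<Sum>k<K. u k n))"
proof (induction K)
  case 0
  show ?case by (simp add: Liminf_const)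
next
  case (Suc K)
  have "(\<Sum>k<Suc K. liminf (\<lambda>n. ereal (u k n)))
      \<le> liminf (\<lambda>n. ereal (\<Sum>k<K. u k n)) + liminf (\<lambda>n. ereal (u K n))"
    using Suc by (simp add: add_right_mono)
  also have "\<dots> \<le> liminf (\<lambda>n. ereal (\<Sum>k<K. u k n) + ereal (u K n))"
    by (rule Liminf_add_le) (auto intro!: always_eventually sum_nonneg assms)
  finally show ?case by simp
qed

text \<open>Fatou's lemma for series: superadditivity of the lower limit handles the partial sums,
  and non-negativity bounds these by the full series. Summability is asked from \<open>N\<close> on
  because real \<open>suminf\<close> is meaningful only for convergent series.\<close>

lemma suminf_liminf_le_liminf_suminf:
  fixes u :: "nat \<Rightarrow> nat \<Rightarrow> real"
  assumes nonneg: "\<And>k n. 0 \<le> u k n"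
    and summable: "\<And>n. n \<ge> N \<Longrightarrow> summable (\<lambda>k. u k n)"
  shows "(\<Sum>k. liminf (\<lambda>n. ereal (u k n))) \<le> liminf (\<lambda>n. ereal (\<Sum>k. u k n))"
proof (intro suminf_bound allI)
  fix K
  have "(\<Sum>k<K. liminf (\<lambda>n. ereal (u k n))) \<le> liminf (\<lambda>n. ereal (\<Sum>k<K. u k n))"
    by (rule sum_liminf_le_liminf_sum) (rule nonneg)
  also have "\<dots> \<le> liminf (\<lambda>n. ereal (\<Sum>k. u k n))"
    using summable nonneg
    by (intro Liminf_mono eventually_sequentiallyI[of N]) (auto intro!: sum_le_suminf)
  finally show "(\<Sum>k<K. liminf (\<lambda>n. ereal (u k n))) \<le> liminf (\<lambda>n. ereal (\<Sum>k. u k n))" .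
qed (auto intro!: Liminf_bounded always_eventually nonneg)

lemma suminf_split_initial_segment_ereal:
  fixes f :: "nat \<Rightarrow> ereal"
  assumes "\<And>i. 0 \<le> f i"
  shows "suminf f = (\<Sum>i<k. f i) + (\<Sum>i. f (i + k))"
proof -
  have "(\<lambda>n. (\<Sum>i<k. f i) + (\<Sum>i<n. f (i + k))) \<longlonglongrightarrow> (\<Sum>i<k. f i) + (\<Sum>i. f (i + k))"
    using assms summable_LIMSEQ[OF summable_ereal_pos, of "\<lambda>i. f (i + k)"]
    by (intro tendsto_add_ereal_nonneg) (auto simp: sum_nonneg suminf_0_le)
  moreover have "(\<Sum>i<k. f i) + (\<Sum>i<n. f (i + k)) = (\<Sum>i<n + k. f i)" for n
    by (induction n) (auto simp: add.assoc [symmetric])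
  moreover have "(\<lambda>n. \<Sum>i<n + k. f i) \<longlonglongrightarrow> suminf f"
    using assms by (intro LIMSEQ_ignore_initial_segment summable_LIMSEQ summable_ereal_pos)
  ultimately show ?thesis
    using LIMSEQ_unique by auto
qed

section \<open>Nodes\<close>

lemma self_in_node: "S \<in> \<S> \<Longrightarrow> S \<in> node \<S> S j"
  by (simp add: node_def)

lemma node_cong: "(\<And>i. i \<le> j \<Longrightarrow> T i = S i) \<Longrightarrow> node \<S> T j = node \<S> S j"
  by (auto simp: node_def)

lemma node_trans: "T \<in> node \<S> S j \<Longrightarrow> U \<in> node \<S> T i \<Longrightarrow> j \<le> i \<Longrightarrow> U \<in> node \<S> S j"
  by (auto simp: node_def)

lemma up_down_node_cong:
  assumes "\<And>i. i \<le> j \<Longrightarrow> T i = S i"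
  shows "up_down_node \<S> T j \<longleftrightarrow> up_down_node \<S> S j"
  using assms node_cong[OF assms, of j]
  by (simp add: up_down_node_def sup_increment_def inf_increment_def)

lemma flat_node_cong:
  assumes "\<And>i. i \<le> j \<Longrightarrow> T i = S i"
  shows "flat_node \<S> T j \<longleftrightarrow> flat_node \<S> S j"
  using assms node_cong[OF assms, of j]
  by (simp add: flat_node_def sup_increment_def inf_increment_def)

lemma arbitrage_node_cong:
  assumes "\<And>i. i \<le> j \<Longrightarrow> T i = S i"
  shows "arbitrage_node \<S> T j \<longleftrightarrow> arbitrage_node \<S> S j"
  using up_down_node_cong[OF assms, of j] flat_node_cong[OF assms, of j]
  by (simp add: arbitrage_node_def)

lemma bad_node_cong:
  assumes "\<And>i. i \<le> j \<Longrightarrow> T i = S i"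
  shows "bad_node \<S> T j \<longleftrightarrow> bad_node \<S> S j"
  using node_cong[OF assms, of j] by (simp add: bad_node_def)

lemma flat_node_eq:
  assumes "flat_node \<S> S j" "T \<in> node \<S> S j"
  shows "T (Suc j) = S j"
proof -
  have "ereal (T (Suc j) - S j) \<le> sup_increment \<S> S j"
    and "inf_increment \<S> S j \<le> ereal (T (Suc j) - S j)"
    using assms(2) by (auto simp: sup_increment_def inf_increment_def intro: SUP_upper INF_lower)
  with assms(1) show ?thesis
    by (simp add: flat_node_def)
qed

lemma up_down_nodeE:
  assumes "up_down_node \<S> S j"
  obtains U D where "U \<in> node \<S> S j" "D \<in> node \<S> S j" "D (Suc j) < S j" "S j < U (Suc j)"
  using assms
  by (auto simp: up_down_node_def sup_increment_def inf_increment_def less_SUP_iff INF_less_iff)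

lemma arbitrage_node_increments:
  assumes "arbitrage_node \<S> S j"
  shows "(\<forall>T\<in>node \<S> S j. S j \<le> T (Suc j)) \<or> (\<forall>T\<in>node \<S> S j. T (Suc j) \<le> S j)"
proof -
  have "sup_increment \<S> S j \<le> 0 \<or> 0 \<le> inf_increment \<S> S j"
    using assms by (auto simp: arbitrage_node_def up_down_node_def)
  then show ?thesis
    by (auto simp: sup_increment_def inf_increment_def SUP_le_iff le_INF_iff)
qed

text \<open>A trajectory \<open>T\<close> witnessing goodness makes no arbitrage move from time
  \<open>j\<close> on. So it stays put at \<open>j\<close>, both at a flat and at an arbitrage node,
  and the same \<open>T\<close> witnesses that \<open>(T, Suc j)\<close> is good.\<close>

lemma good_node_stay:
  assumes "good_node \<S> S j" "\<not> up_down_node \<S> S j"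
  obtains T where "T \<in> node \<S> S j" "T (Suc j) = S j" "good_node \<S> T (Suc j)"
proof -
  obtain T where T: "T \<in> node \<S> S j" "\<And>k. k \<ge> j \<Longrightarrow> arbitrage_node \<S> T k \<Longrightarrow> T (Suc k) = T k"
    using assms(1) unfolding bad_node_def by blast
  have "T (Suc j) = S j"
  proof (cases "flat_node \<S> S j")
    case True
    then show ?thesis using flat_node_eq T(1) by blast
  next
    case False
    then have "arbitrage_node \<S> S j"
      using assms(2) by (simp add: arbitrage_node_def)
    then have "arbitrage_node \<S> T j"
      using T(1) arbitrage_node_cong[of j T S] by (auto simp: node_def)
    then show ?thesis using T by (auto simp: node_def)
  qed
  moreover have "good_node \<S> T (Suc j)"
    using T self_in_node[of T \<S> "Suc j"] unfolding bad_node_def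
    by (metis (no_types, lifting) Suc_leD mem_Collect_eq node_def)
  ultimately show ?thesis using that T(1) by blast
qed

text \<open>An up-down node has successors strictly on both sides. If one of them is bad,
  \<open>P_bad\<close> applied to that successor yields a good one even further out on the same
  side.\<close>

lemma good_up_down_nodeE:
  assumes "P_bad \<S>" "S \<in> \<S>" "good_node \<S> S j" "up_down_node \<S> S j"
  obtains U D where "U \<in> node \<S> S j" "D \<in> node \<S> S j" "D (Suc j) < S j" "S j < U (Suc j)"
    "good_node \<S> U (Suc j)" "good_node \<S> D (Suc j)"
proof -
  obtain U D where UD: "U \<in> node \<S> S j" "D \<in> node \<S> S j" "D (Suc j) < S j" "S j < U (Suc j)"
    using up_down_nodeE[OF assms(4)] .
  have surround: "\<exists>S1\<in>node \<S> S j. \<exists>S2\<in>node \<S> S j.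
      T (Suc j) < S1 (Suc j) \<and> S2 (Suc j) < T (Suc j) \<and>
      good_node \<S> S1 (Suc j) \<and> good_node \<S> S2 (Suc j)"
    if T: "T \<in> node \<S> S j" "bad_node \<S> T (Suc j)" for T
  proof -
    have eq: "\<And>i. i \<le> j \<Longrightarrow> T i = S i" and "T \<in> \<S>"
      using T by (auto simp: node_def)
    then have "good_node \<S> T j" "up_down_node \<S> T j" "node \<S> T j = node \<S> S j"
      using assms bad_node_cong[OF eq, of j] up_down_node_cong[OF eq, of j] node_cong[OF eq, of j]
      by auto
    with \<open>T \<in> \<S>\<close> T(2) assms(1) show ?thesis
      unfolding P_bad_def by (metis (no_types, lifting))
  qed
  have "\<exists>U\<in>node \<S> S j. S j < U (Suc j) \<and> good_node \<S> U (Suc j)"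
    using UD surround[of U] by (metis less_trans)
  moreover have "\<exists>D\<in>node \<S> S j. D (Suc j) < S j \<and> good_node \<S> D (Suc j)"
    using UD surround[of D] by (metis less_trans)
  ultimately show ?thesis using that by blast
qed

section \<open>Portfolios\<close>

lemma portfolio_Suc:
  "j \<le> n \<Longrightarrow> portfolio j V H (Suc n) T = portfolio j V H n T + H n T * (T (Suc n) - T n)"
  by (simp add: portfolio_def)

lemma portfolio_initial [simp]: "n \<le> j \<Longrightarrow> portfolio j V H n T = V"
  by (simp add: portfolio_def)

lemma strategy_cong:
  assumes "H \<in> strategies \<S> S j" "T \<in> node \<S> S j" "U \<in> node \<S> T i" "j \<le> i"
  shows "H i U = H i T"
proof -
  have "\<forall>k. j \<le> k \<and> k \<le> i \<longrightarrow> U k = T k"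
    using assms(3) by (simp add: node_def)
  with assms(1,2,4) node_trans[OF assms(2,3,4)] show ?thesis
    unfolding strategies_def by blast
qed

lemma strategies_truncate:
  assumes "H \<in> strategies \<S> S j"
  shows "(\<lambda>i T. if i < n then H i T else 0) \<in> strategies \<S> S j"
proof -
  have "(if i < n then H i T else 0) = (if i < n then H i U else 0)"
    if "j \<le> i" "T \<in> node \<S> S j" "U \<in> node \<S> S j" "\<forall>k. j \<le> k \<and> k \<le> i \<longrightarrow> T k = U k"
    for i T U
  proof -
    have "H i T = H i U" using assms that unfolding strategies_def by blast
    then show ?thesis by (rule arg_cong)
  qed
  then show ?thesis unfolding strategies_def by blast
qed

lemma portfolio_cong:
  assumes "H \<in> strategies \<S> S j" "T \<in> node \<S> S j" "U \<in> node \<S> T n" "j \<le> n"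
  shows "portfolio j V H n U = portfolio j V H n T"
proof -
  have "H i U = H i T" if "i \<in> {j..<n}" for i
    using that assms by (intro strategy_cong[OF assms(1,2)]) (auto simp: node_def)
  then show ?thesis
    using assms(3) unfolding portfolio_def node_def
    by (auto intro!: arg_cong[where f = "(+) V"] sum.cong)
qed

lemma nonneg_portfolio_nonneg:
  assumes "nonneg_portfolio \<S> S j V H" "T \<in> node \<S> S j"
  shows "0 \<le> portfolio j V H n T"
proof (cases "j \<le> n")
  case False
  have "0 \<le> portfolio j V H j T"
    using assms unfolding nonneg_portfolio_def by blast
  with False show ?thesis by simp
qed (use assms in \<open>auto simp: nonneg_portfolio_def\<close>)

lemma nonneg_portfolio_initial:
  assumes "nonneg_portfolio \<S> S j V H" "T \<in> node \<S> S j"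
  shows "0 \<le> V"
  using nonneg_portfolio_nonneg[OF assms, of j] by simp

lemma limit_portfolio_nonneg:
  assumes "nonneg_portfolio \<S> S j V H" "T \<in> node \<S> S j"
  shows "0 \<le> limit_portfolio j V H T"
  unfolding limit_portfolio_def using nonneg_portfolio_nonneg[OF assms]
  by (intro Liminf_bounded) auto

lemma superhedge_le:
  fixes V :: "nat \<Rightarrow> real"
  assumes "\<And>m. nonneg_portfolio \<S> S j (V m) (H m)"
    and "\<And>T. T \<in> node \<S> S j \<Longrightarrow> f T \<le> (\<Sum>m. limit_portfolio j (V m) (H m) T)"
  shows "superhedge \<S> j f S \<le> (\<Sum>m. ereal (V m))"
  unfolding superhedge_def using assms by (intro Inf_lower) auto

lemma superhedge_nonneg:
  assumes "S \<in> \<S>"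
  shows "0 \<le> superhedge \<S> j f S"
  unfolding superhedge_def
proof (rule Inf_greatest, clarify)
  fix V :: "nat \<Rightarrow> real" and H
  assume *: "\<forall>m. nonneg_portfolio \<S> S j (V m) (H m)"
  show "0 \<le> (\<Sum>m. ereal (V m))"
    using * nonneg_portfolio_initial[OF _ self_in_node[OF assms]]
    by (intro suminf_0_le) (auto simp: zero_ereal_def)
qed

section \<open>Moves at arbitrage nodes\<close>

definition arbitrage_move :: "trajectory set \<Rightarrow> trajectory \<Rightarrow> nat \<Rightarrow> bool" where
  "arbitrage_move \<S> T k \<longleftrightarrow> arbitrage_node \<S> T k \<and> T (Suc k) \<noteq> T k"

text \<open>One unit in the direction that cannot lose: at an arbitrage node all increments have the
  same weak sign.\<close>

definition arbitrage_strategy :: "trajectory set \<Rightarrow> nat \<Rightarrow> trajectory \<Rightarrow> real" where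
  "arbitrage_strategy \<S> i T =
     (if \<not> arbitrage_node \<S> T i then 0
      else if \<forall>U\<in>node \<S> T i. T i \<le> U (Suc i) then 1 else -1)"

lemma arbitrage_strategy_cong:
  assumes "\<And>k. k \<le> i \<Longrightarrow> T k = U k"
  shows "arbitrage_strategy \<S> i T = arbitrage_strategy \<S> i U"
  using assms node_cong[OF assms, of i] arbitrage_node_cong[OF assms, of i]
  by (simp add: arbitrage_strategy_def)

lemma arbitrage_strategy_in_strategies: "arbitrage_strategy \<S> \<in> strategies \<S> S j"
proof -
  have "arbitrage_strategy \<S> i T = arbitrage_strategy \<S> i U"
    if "T \<in> node \<S> S j" "U \<in> node \<S> S j" "\<forall>k. j \<le> k \<and> k \<le> i \<longrightarrow> T k = U k" for i T U
  proof (rule arbitrage_strategy_cong)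
    fix k assume "k \<le> i"
    with that show "T k = U k" by (cases "j \<le> k") (auto simp: node_def)
  qed
  then show ?thesis unfolding strategies_def by blast
qed

lemma arbitrage_gain_nonneg:
  assumes "T \<in> \<S>"
  shows "0 \<le> arbitrage_strategy \<S> i T * (T (Suc i) - T i)"
proof (cases "arbitrage_node \<S> T i")
  case True
  with arbitrage_node_increments[OF this] self_in_node[OF assms, of i] show ?thesis
    unfolding arbitrage_strategy_def by (cases "\<forall>U\<in>node \<S> T i. T i \<le> U (Suc i)") simp_all
qed (simp add: arbitrage_strategy_def)

lemma arbitrage_gain_pos:
  assumes "T \<in> \<S>" "arbitrage_move \<S> T i"
  shows "0 < arbitrage_strategy \<S> i T * (T (Suc i) - T i)"
proof -
  have "arbitrage_strategy \<S> i T \<noteq> 0" "T (Suc i) - T i \<noteq> 0"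
    using assms(2) by (simp_all add: arbitrage_move_def arbitrage_strategy_def)
  with arbitrage_gain_nonneg[OF assms(1), of i] show ?thesis
    by (metis less_le mult_eq_0_iff)
qed

lemma nonneg_portfolio_arbitrage: "nonneg_portfolio \<S> S j 0 (arbitrage_strategy \<S>)"
  unfolding nonneg_portfolio_def portfolio_def
  by (auto intro!: sum_nonneg arbitrage_gain_nonneg arbitrage_strategy_in_strategies simp: node_def)

text \<open>No trade of this strategy ever loses, so the strictly positive gain made at time
  \<open>k\<close> is kept and bounds the wealth from below ever after.\<close>

lemma limit_portfolio_arbitrage_pos:
  assumes "T \<in> \<S>" "j \<le> k" "arbitrage_move \<S> T k"
  shows "0 < limit_portfolio j 0 (arbitrage_strategy \<S>) T"
proof -
  define gain where "gain = (\<lambda>i. arbitrage_strategy \<S> i T * (T (Suc i) - T i))"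
  have "gain k \<le> portfolio j 0 (arbitrage_strategy \<S>) n T" if "n \<ge> Suc k" for n
    unfolding portfolio_def gain_def using that assms(2)
    by (auto intro!: member_le_sum arbitrage_gain_nonneg assms(1))
  then have "ereal (gain k) \<le> limit_portfolio j 0 (arbitrage_strategy \<S>) T"
    unfolding limit_portfolio_def
    by (intro Liminf_bounded eventually_sequentiallyI[of "Suc k"]) auto
  moreover have "0 < gain k"
    unfolding gain_def using assms by (intro arbitrage_gain_pos)
  ultimately show ?thesis
    by (metis ereal_less(2) less_le_trans)
qed

lemma suminf_const_pos_ereal:
  assumes "(0::ereal) < c"
  shows "(\<Sum>m::nat. c) = \<infinity>"
proof (rule ccontr)
  assume "(\<Sum>m::nat. c) \<noteq> \<infinity>"
  then have "\<bar>\<Sum>m::nat. c\<bar> \<noteq> \<infinity>" "\<bar>c\<bar> \<noteq> \<infinity>"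
    using assms suminf_0_le[of "\<lambda>_. c"] suminf_PInfty[of "\<lambda>_. c" 0] by force+
  then obtain r x where "c = ereal r" "(\<Sum>m::nat. c) = ereal x"
    by (metis ereal_real')
  then have "summable (\<lambda>m::nat. r)"
    using assms by (intro summable_ereal) (auto simp: less_imp_le)
  then show False
    using assms \<open>c = ereal r\<close> by (simp add: summable_const_iff)
qed

lemma null_set_arbitrage_moves:
  "null_set \<S> {T\<in>\<S>. \<exists>k. arbitrage_move \<S> T k}" (is "null_set \<S> ?N")
proof -
  have "superhedge \<S> 0 (indicator ?N) S = 0" if "S \<in> \<S>" for S
  proof (rule antisym)
    have "superhedge \<S> 0 (indicator ?N) S \<le> (\<Sum>m::nat. ereal 0)"
    proof (rule superhedge_le[where H = "\<lambda>_. arbitrage_strategy \<S>"])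
      fix T assume T: "T \<in> node \<S> S 0"
      have "0 \<le> (\<Sum>m::nat. limit_portfolio 0 0 (arbitrage_strategy \<S>) T)"
        using limit_portfolio_nonneg[OF nonneg_portfolio_arbitrage T] by (intro suminf_0_le)
      then show "indicator ?N T \<le> (\<Sum>m::nat. limit_portfolio 0 0 (arbitrage_strategy \<S>) T)"
        using limit_portfolio_arbitrage_pos[of T \<S> 0]
        by (auto simp: indicator_def suminf_const_pos_ereal)
    qed (rule nonneg_portfolio_arbitrage)
    then show "superhedge \<S> 0 (indicator ?N) S \<le> 0"
      by (simp flip: zero_ereal_def)
  qed (rule superhedge_nonneg[OF that])
  then show ?thesis by (auto simp: null_set_def)
qed

text \<open>Used in contrapositive form: a trajectory without arbitrage moves from \<open>j\<close>
  on passes only through good nodes from \<open>j\<close> on.\<close>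

lemma bad_node_arbitrage_move:
  assumes "T \<in> node \<S> S j" "bad_node \<S> S j"
  shows "\<exists>k\<ge>j. arbitrage_move \<S> T k"
  using assms unfolding bad_node_def arbitrage_move_def by blast

section \<open>Aggregating a countable family of portfolios at a good node\<close>

text \<open>The member with index 0 plays the role of an elementary function with horizon \<open>n0\<close>: it may
  take negative values, but it is constant in time from \<open>n0\<close> on.\<close>

locale hedge_family =
  fixes \<S> :: "trajectory set" and S :: trajectory and j n0 :: nat
    and V :: "nat \<Rightarrow> real" and H :: "nat \<Rightarrow> nat \<Rightarrow> trajectory \<Rightarrow> real"
  assumes TC: "TC_bad \<S>" and P: "P_bad \<S>"
    and S_in: "S \<in> \<S>" and good: "good_node \<S> S j"
    and strategies: "\<And>m. H m \<in> strategies \<S> S j"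
    and nonneg: "\<And>m. nonneg_portfolio \<S> S j (V (Suc m)) (H (Suc m))"
    and horizon: "\<And>i T. n0 \<le> i \<Longrightarrow> H 0 i T = 0"
    and summable_V: "summable V"
    and cover: "\<And>T. T \<in> node \<S> S j \<Longrightarrow>
      0 \<le> ereal (portfolio j (V 0) (H 0) n0 T) + (\<Sum>m. limit_portfolio j (V (Suc m)) (H (Suc m)) T)"
begin

abbreviation member :: "nat \<Rightarrow> nat \<Rightarrow> trajectory \<Rightarrow> real" where
  "member m n T \<equiv> portfolio j (V m) (H m) n T"

section \<open>One-step behaviour of the aggregated value\<close>

text \<open>Real \<open>suminf\<close> says nothing for a divergent series, so summability of the
  member values is carried along separately below.\<close>

definition total :: "nat \<Rightarrow> trajectory \<Rightarrow> real" where
  "total n T = (\<Sum>m. member m n T)"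

definition total_strategy :: "nat \<Rightarrow> trajectory \<Rightarrow> real" where
  "total_strategy n T = (\<Sum>m. H m n T)"

lemma member_step:
  assumes "T \<in> node \<S> S j" "j \<le> n" "U \<in> node \<S> T n"
  shows "member m (Suc n) U = member m n T + H m n T * (U (Suc n) - T n)"
  using assms(3) portfolio_cong[OF strategies assms(1,3,2), of "V m" m]
    strategy_cong[OF strategies assms(1,3,2), of m]
  by (simp add: portfolio_Suc assms(2) node_def)

text \<open>Let the node allow a rise by \<open>a\<close> and a fall by \<open>b\<close>. A member
  that is still non-negative after either move has a position between -value/\<open>a\<close> and
  value/\<open>b\<close>, so the summable values dominate the positions. Member 0 may be negative,
  but a single term does not affect summability.\<close>

lemma summable_strategy:
  assumes T: "T \<in> node \<S> S j" and n: "j \<le> n" and ud: "up_down_node \<S> T n"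
    and sm: "summable (\<lambda>m. member m n T)"
  shows "summable (\<lambda>m. H m n T)"
proof -
  obtain U D where UD: "U \<in> node \<S> T n" "D \<in> node \<S> T n" "D (Suc n) < T n" "T n < U (Suc n)"
    using up_down_nodeE[OF ud] .
  define a b where "a = U (Suc n) - T n" and "b = T n - D (Suc n)"
  have ab: "0 < a" "0 < b" using UD by (auto simp: a_def b_def)
  have bound: "\<bar>H (Suc m) n T\<bar> \<le> member (Suc m) n T * (1 / a + 1 / b)" for m
  proof -
    have "0 \<le> member (Suc m) (Suc n) X" if "X \<in> node \<S> T n" for X
      using nonneg_portfolio_nonneg[OF nonneg node_trans[OF T that n]] .
    from this[OF UD(1)] this[OF UD(2)]
    have "0 \<le> member (Suc m) n T + H (Suc m) n T * a" "0 \<le> member (Suc m) n T - H (Suc m) n T * b"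
      unfolding member_step[OF T n UD(1)] member_step[OF T n UD(2)] a_def b_def
      by (simp_all add: algebra_simps)
    then have "- (member (Suc m) n T / a) \<le> H (Suc m) n T" "H (Suc m) n T \<le> member (Suc m) n T / b"
      using ab by (simp_all add: field_simps)
    moreover have "0 \<le> member (Suc m) n T / a" "0 \<le> member (Suc m) n T / b"
      using ab nonneg_portfolio_nonneg[OF nonneg T, of m n] by simp_all
    ultimately show ?thesis by (simp add: distrib_left abs_le_iff)
  qed
  have "summable (\<lambda>m. member (Suc m) n T * (1 / a + 1 / b))"
    using summable_Suc_iff[of "\<lambda>m. member m n T"] sm by (intro summable_mult2) simp
  then have "summable (\<lambda>m. H (Suc m) n T)"
    by (rule summable_comparison_test'[where N = 0]) (use bound in simp)
  then show ?thesis
    using summable_Suc_iff[of "\<lambda>m. H m n T"] by simp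
qed

lemma total_step:
  assumes T: "T \<in> node \<S> S j" "j \<le> n" and ud: "up_down_node \<S> T n"
    and sm: "summable (\<lambda>m. member m n T)" and U: "U \<in> node \<S> T n"
  shows "summable (\<lambda>m. member m (Suc n) U)"
    and "total (Suc n) U = total n T + total_strategy n T * (U (Suc n) - T n)"
proof -
  have "(\<lambda>m. member m n T + H m n T * (U (Suc n) - T n)) sums
      (total n T + total_strategy n T * (U (Suc n) - T n))"
    unfolding total_def total_strategy_def
    by (intro sums_add sums_mult2 summable_sums sm summable_strategy T ud)
  then show "summable (\<lambda>m. member m (Suc n) U)"
    and "total (Suc n) U = total n T + total_strategy n T * (U (Suc n) - T n)"
    by (auto simp: member_step[OF T U] total_def sums_iff)
qed

text \<open>Off up-down nodes the positions need not be summable; here the zero increment removes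
  every member's gain before any summation.\<close>

lemma total_stay:
  assumes "T \<in> node \<S> S j" "j \<le> n" "summable (\<lambda>m. member m n T)"
    and "U \<in> node \<S> T n" "U (Suc n) = T n"
  shows "summable (\<lambda>m. member m (Suc n) U)" and "total (Suc n) U = total n T"
  using assms by (simp_all add: member_step[OF assms(1,2,4)] total_def)

lemma total_initial: "total j T = suminf V" "summable (\<lambda>m. member m j T)"
  using summable_V by (simp_all add: total_def)

text \<open>Fatou's lemma applies to the members of positive index. Member 0 is constant from
  \<open>n0\<close> on, hence can be moved inside the lower limit.\<close>

lemma le_liminf_total:
  assumes T: "T \<in> node \<S> S j" and sm: "\<And>n. N \<le> n \<Longrightarrow> summable (\<lambda>m. member m n T)"
  shows "ereal (member 0 n0 T) + (\<Sum>m. limit_portfolio j (V (Suc m)) (H (Suc m)) T)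
    \<le> liminf (\<lambda>n. ereal (total n T))"
proof -
  have const: "member 0 n T = member 0 n0 T" if "n0 \<le> n" for n
    using that by (induction n rule: dec_induct) (auto simp: portfolio_def horizon)
  have "ereal (member 0 n0 T) + (\<Sum>m. limit_portfolio j (V (Suc m)) (H (Suc m)) T)
      \<le> ereal (member 0 n0 T) + liminf (\<lambda>n. ereal (\<Sum>m. member (Suc m) n T))"
    unfolding limit_portfolio_def
    using summable_Suc_iff[of "\<lambda>m. member m n T" for n] sm nonneg_portfolio_nonneg[OF nonneg T]
    by (intro add_left_mono suminf_liminf_le_liminf_suminf[of _ N]) auto
  also have "\<dots> = liminf (\<lambda>n. ereal (member 0 n0 T) + ereal (\<Sum>m. member (Suc m) n T))"
    by (rule Liminf_add_ereal_left [symmetric]) auto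
  also have "\<dots> = liminf (\<lambda>n. ereal (total n T))"
  proof (rule Liminf_eq, rule eventually_sequentiallyI[of "max n0 N"])
    fix n assume "max n0 N \<le> n"
    then show "ereal (member 0 n0 T) + ereal (\<Sum>m. member (Suc m) n T) = ereal (total n T)"
      using suminf_split_head[OF sm, of n] const[of n] by (simp add: total_def)
  qed
  finally show ?thesis .
qed

section \<open>Non-negativity of the aggregated value at good nodes\<close>

text \<open>At an up-down node \<open>total\<close> is affine in the increment with slope
  \<open>total_strategy\<close>, so a good successor on the losing side does not increase it. At any
  other good node some good successor stays put.\<close>

lemma total_descent_step:
  assumes T: "T \<in> node \<S> S j" "j \<le> n" and g: "good_node \<S> T n"
    and sm: "summable (\<lambda>m. member m n T)"
  shows "\<exists>U\<in>node \<S> T n. good_node \<S> U (Suc n) \<and> summable (\<lambda>m. member m (Suc n) U) \<and>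
    total (Suc n) U \<le> total n T"
proof (cases "up_down_node \<S> T n")
  case ud: True
  have "T \<in> \<S>" using T by (simp add: node_def)
  then obtain U D where UD: "U \<in> node \<S> T n" "D \<in> node \<S> T n" "D (Suc n) < T n" "T n < U (Suc n)"
    "good_node \<S> U (Suc n)" "good_node \<S> D (Suc n)"
    using good_up_down_nodeE[OF P _ g ud] by blast
  define X where "X = (if 0 \<le> total_strategy n T then D else U)"
  have "total_strategy n T * (X (Suc n) - T n) \<le> 0"
    using UD by (auto simp: X_def mult_le_0_iff)
  moreover have "X \<in> node \<S> T n" "good_node \<S> X (Suc n)"
    using UD by (auto simp: X_def)
  ultimately show ?thesis
    using total_step[OF T ud sm] by (intro bexI[of _ X]) auto
next
  case False
  then show ?thesis
    using good_node_stay[OF g] total_stay[OF T sm] by (metis order_refl)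
qed

text \<open>Iterating the descent gives trajectories agreeing on ever longer initial segments. By
  \<open>TC_bad\<close> their diagonal limit \<open>L\<close> lies in \<open>\<S>\<close>;
  \<open>cover\<close> and Fatou's lemma make the lower limit of \<open>total\<close> along
  \<open>L\<close> non-negative, while \<open>total i T\<close> bounds it from above.\<close>

lemma total_nonneg:
  assumes T: "T \<in> node \<S> S j" "j \<le> i" and g: "good_node \<S> T i"
    and sm: "summable (\<lambda>m. member m i T)"
  shows "0 \<le> total i T"
proof -
  define inv where "inv = (\<lambda>n X. X \<in> node \<S> T i \<and> good_node \<S> X (i + n) \<and>
    summable (\<lambda>m. member m (i + n) X) \<and> total (i + n) X \<le> total i T)"
  have "\<exists>Z. \<forall>n. inv n (Z n) \<and> Z (Suc n) \<in> node \<S> (Z n) (i + n)"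
  proof (rule dependent_nat_choice)
    show "\<exists>X. inv 0 X"
      using T g sm by (auto simp: inv_def node_def)
  next
    fix X n
    assume X: "inv n X"
    then have "X \<in> node \<S> S j" using T node_trans by (auto simp: inv_def)
    then obtain U where "U \<in> node \<S> X (i + n)" "good_node \<S> U (Suc (i + n))"
      "summable (\<lambda>m. member m (Suc (i + n)) U)" "total (Suc (i + n)) U \<le> total (i + n) X"
      using total_descent_step[of X "i + n"] X T(2) by (auto simp: inv_def)
    moreover from this have "U \<in> node \<S> T i"
      using X node_trans[of X \<S> T i U "i + n"] by (simp add: inv_def)
    ultimately show "\<exists>Y. inv (Suc n) Y \<and> Y \<in> node \<S> X (i + n)"
      using X by (auto simp: inv_def)
  qed
  then obtain Z where Z: "\<And>n. inv n (Z n)" "\<And>n. Z (Suc n) \<in> node \<S> (Z n) (i + n)"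
    by blast
  \<comment> \<open>\<open>Z n\<close> lives at time \<open>i + n\<close>, whereas
    \<open>TC_bad\<close> expects the n-th trajectory at time n. Truncated subtraction fills the
    times before \<open>i\<close> with \<open>Z 0\<close>.\<close>
  define W where "W = (\<lambda>n. Z (n - i))"
  define L where "L = (\<lambda>n. W n n)"
  have W_in: "W n \<in> \<S>" for n
    using Z(1) by (auto simp: W_def inv_def node_def)
  have W_Suc: "W (Suc n) k = W n k" if "k \<le> n" for n k
  proof (cases "i \<le> n")
    case True
    then have "W (Suc n) \<in> node \<S> (W n) n"
      using Z(2)[of "n - i"] by (simp add: W_def Suc_diff_le)
    then show ?thesis using that by (simp add: node_def)
  qed (simp add: W_def)
  have good_W: "good_node \<S> (W n) n" if "i \<le> n" for n
    using Z(1)[of "n - i"] that by (simp add: W_def inv_def)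
  have L_in: "L \<in> \<S>"
    using TC W_in W_Suc good_W unfolding TC_bad_def L_def by metis
  have L_eq: "L k = W n k" if "k \<le> n" for n k
    using that by (induction n rule: dec_induct) (auto simp: L_def W_Suc)
  have L_node: "L \<in> node \<S> (W n) n" for n
    using L_in L_eq by (simp add: node_def)
  have W_node: "W n \<in> node \<S> S j" for n
    using Z(1)[of "n - i"] node_trans[OF T(1) _ T(2)] by (simp add: W_def inv_def)
  have L_total: "summable (\<lambda>m. member m n L) \<and> total n L \<le> total i T" if "i \<le> n" for n
  proof -
    \<comment> \<open>Values at time \<open>n\<close> depend only on the path up to
      \<open>n\<close>, where \<open>L\<close> and \<open>W n\<close> agree.\<close>
    have "member m n L = member m n (W n)" for m
      using that T(2) by (intro portfolio_cong[OF strategies W_node L_node]) simp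
    then show ?thesis
      using Z(1)[of "n - i"] that by (simp add: total_def W_def inv_def)
  qed
  have L_S: "L \<in> node \<S> S j"
    using node_trans[OF W_node L_node T(2)] .
  then have "0 \<le> liminf (\<lambda>n. ereal (total n L))"
    using cover[OF L_S] le_liminf_total[OF L_S, of i] L_total by (meson order_trans)
  also have "\<dots> \<le> liminf (\<lambda>n. ereal (total i T))"
    using L_total by (intro Liminf_mono eventually_sequentiallyI[of i]) auto
  finally show ?thesis by (simp add: Liminf_const)
qed

section \<open>The aggregated strategy stopped at the first arbitrage move or bad node\<close>

text \<open>Goodness is tested up to \<open>n\<close>, moves only before \<open>n\<close>: a move at
  \<open>n\<close> is visible only at time \<open>Suc n\<close>. This keeps the stopping rule
  non-anticipative.\<close>

definition live :: "trajectory \<Rightarrow> nat \<Rightarrow> bool" where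
  "live T n \<longleftrightarrow> (\<forall>l\<in>{j..n}. good_node \<S> T l) \<and> (\<forall>l\<in>{j..<n}. \<not> arbitrage_move \<S> T l)"

lemma live_cong:
  assumes "\<And>k. k \<le> n \<Longrightarrow> U k = T k"
  shows "live U n \<longleftrightarrow> live T n"
proof -
  have "bad_node \<S> U l \<longleftrightarrow> bad_node \<S> T l" if "l \<in> {j..n}" for l
    using that assms by (intro bad_node_cong) auto
  moreover have "arbitrage_move \<S> U l \<longleftrightarrow> arbitrage_move \<S> T l" if "l \<in> {j..<n}" for l
    using that assms arbitrage_node_cong[of l U T] by (auto simp: arbitrage_move_def)
  ultimately show ?thesis by (auto simp: live_def)
qed

lemma live_Suc:
  assumes "j \<le> n"
  shows "live T (Suc n) \<longleftrightarrow> live T n \<and> good_node \<S> T (Suc n) \<and> \<not> arbitrage_move \<S> T n"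
  using assms by (auto simp: live_def less_Suc_eq le_Suc_eq)

lemma live_initial: "T \<in> node \<S> S j \<Longrightarrow> live T j"
  using good bad_node_cong[of j T S] by (auto simp: live_def node_def)

lemma live_not_up_down_stay:
  assumes "T \<in> \<S>" "\<not> up_down_node \<S> T n" "\<not> arbitrage_move \<S> T n"
  shows "T (Suc n) = T n"
  using assms flat_node_eq[OF _ self_in_node[OF assms(1)]]
  by (auto simp: arbitrage_move_def arbitrage_node_def)

text \<open>Each step of a live trajectory either leaves an up-down node or does not move, so
  summability propagates from the initial capitals.\<close>

lemma live_summable:
  assumes T: "T \<in> node \<S> S j" and n: "j \<le> n" and "live T n"
  shows "summable (\<lambda>m. member m n T)"
  using n assms(3)
proof (induction n rule: dec_induct)
  case base
  show ?case by (rule total_initial)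
next
  case (step n)
  have "T \<in> \<S>" using T by (simp add: node_def)
  from step have live: "live T n" "\<not> arbitrage_move \<S> T n" and sm: "summable (\<lambda>m. member m n T)"
    by (auto simp: live_Suc)
  note T_node = self_in_node[OF \<open>T \<in> \<S>\<close>, of n]
  show ?case
  proof (cases "up_down_node \<S> T n")
    case True
    then show ?thesis using total_step(1)[OF T step(1) _ sm T_node] by blast
  next
    case False
    then show ?thesis
      using total_stay(1)[OF T step(1) sm T_node] live_not_up_down_stay[OF \<open>T \<in> \<S>\<close>] live by blast
  qed
qed

text \<open>At a live up-down node the series of positions converges. At other live nodes it may
  diverge, and the zero position costs nothing as long as the trajectory stays live, since then it
  does not move.\<close>

definition hedge :: "nat \<Rightarrow> trajectory \<Rightarrow> real" where
  "hedge n T = (if live T n \<and> up_down_node \<S> T n then total_strategy n T else 0)"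

abbreviation hedge_value :: "nat \<Rightarrow> trajectory \<Rightarrow> real" where
  "hedge_value n T \<equiv> portfolio j (suminf V) hedge n T"

lemma hedge_in_strategies: "hedge \<in> strategies \<S> S j"
proof -
  have "hedge i T = hedge i U"
    if i: "j \<le> i" and TU: "T \<in> node \<S> S j" "U \<in> node \<S> S j"
      and agree: "\<forall>k. j \<le> k \<and> k \<le> i \<longrightarrow> T k = U k" for i T U
  proof -
    have eq: "T k = U k" if "k \<le> i" for k
      using TU agree that by (cases "j \<le> k") (auto simp: node_def)
    then have "T \<in> node \<S> U i" using TU by (simp add: node_def)
    then have "total_strategy i T = total_strategy i U"
      using strategy_cong[OF strategies TU(2) _ i] by (simp add: total_strategy_def)
    then show ?thesis
      using live_cong[OF eq, of i] up_down_node_cong[OF eq, of i] by (simp add: hedge_def)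
  qed
  then show ?thesis unfolding strategies_def by blast
qed

lemma hedge_value_live:
  assumes T: "T \<in> node \<S> S j" and n: "j \<le> n" and "live T n"
  shows "hedge_value n T = total n T"
  using n assms(3)
proof (induction n rule: dec_induct)
  case base
  show ?case by (simp add: total_initial)
next
  case (step n)
  have "T \<in> \<S>" using T by (simp add: node_def)
  from step have live: "live T n" "\<not> arbitrage_move \<S> T n" and eq: "hedge_value n T = total n T"
    by (auto simp: live_Suc)
  note T_node = self_in_node[OF \<open>T \<in> \<S>\<close>, of n]
  note sm = live_summable[OF T step(1) live(1)]
  show ?case
  proof (cases "up_down_node \<S> T n")
    case True
    then show ?thesis
      using total_step(2)[OF T step(1) _ sm T_node] live
      by (simp add: portfolio_Suc[OF step(1)] eq) (simp add: hedge_def)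
  next
    case False
    then show ?thesis
      using total_stay(2)[OF T step(1) sm T_node] live_not_up_down_stay[OF \<open>T \<in> \<S>\<close> False live(2)]
      by (simp add: portfolio_Suc[OF step(1)] eq)
  qed
qed

lemma hedge_value_live_nonneg:
  assumes "T \<in> node \<S> S j" "j \<le> n" "live T n"
  shows "0 \<le> hedge_value n T"
  using assms total_nonneg[OF assms(1,2) _ live_summable[OF assms]]
  by (simp add: hedge_value_live live_def)

text \<open>When a live up-down node has a bad successor, \<open>P_bad\<close> surrounds it by two live successors,
  and the value there is affine in the increment.\<close>

lemma hedge_value_nonneg:
  assumes T: "T \<in> node \<S> S j" and n: "j \<le> n"
  shows "0 \<le> hedge_value n T"
  using n
proof (induction n rule: dec_induct)
  case base
  show ?case using hedge_value_live_nonneg[OF T _ live_initial[OF T]] by simp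
next
  case (step n)
  have "T \<in> \<S>" using T by (simp add: node_def)
  show ?case
  proof (cases "live T n \<and> up_down_node \<S> T n")
    case False
    then have "hedge n T = 0" unfolding hedge_def by (rule if_not_P)
    then show ?thesis using step by (simp add: portfolio_Suc)
  next
    case True
    then have live: "live T n" and ud: "up_down_node \<S> T n" and g: "good_node \<S> T n"
      using step(1) by (auto simp: live_def)
    \<comment> \<open>An up-down node is not an arbitrage node, so leaving it is never an arbitrage
      move; only goodness of the successor matters.\<close>
    have live_succ: "live U (Suc n)" if U: "U \<in> node \<S> T n" "good_node \<S> U (Suc n)" for U
    proof -
      have eq: "\<And>k. k \<le> n \<Longrightarrow> U k = T k" using U by (simp add: node_def)
      have "up_down_node \<S> U n" "live U n"
        using ud live up_down_node_cong[OF eq, of n] live_cong[OF eq, of n] by auto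
      then show ?thesis
        using U(2) step(1) by (simp add: live_Suc arbitrage_move_def arbitrage_node_def)
    qed
    have value_Suc: "hedge_value (Suc n) U
        = hedge_value n T + hedge n T * (U (Suc n) - T n)" if "U \<in> node \<S> T n" for U
      using that step(1) portfolio_cong[OF hedge_in_strategies T that]
        strategy_cong[OF hedge_in_strategies T that]
      by (simp add: portfolio_Suc node_def)
    show ?thesis
    proof (cases "bad_node \<S> T (Suc n)")
      case False
      then show ?thesis
        using hedge_value_live_nonneg[OF T _ live_succ] self_in_node[OF \<open>T \<in> \<S>\<close>] step(1) by simp
    next
      case True
      then obtain U D where UD: "U \<in> node \<S> T n" "D \<in> node \<S> T n"
        "T (Suc n) < U (Suc n)" "D (Suc n) < T (Suc n)"
        "good_node \<S> U (Suc n)" "good_node \<S> D (Suc n)"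
        using P \<open>T \<in> \<S>\<close> g ud unfolding P_bad_def by blast
      have succ: "0 \<le> hedge_value (Suc n) X" if "X \<in> node \<S> T n" "good_node \<S> X (Suc n)" for X
        using that step(1) node_trans[OF T that(1) step(1)]
        by (intro hedge_value_live_nonneg live_succ) auto
      have nonneg: "0 \<le> hedge_value n T + hedge n T * (U (Suc n) - T n)"
        "0 \<le> hedge_value n T + hedge n T * (D (Suc n) - T n)"
        using succ UD value_Suc by auto
      have "0 \<le> hedge_value n T + hedge n T * (T (Suc n) - T n)"
      \<comment> \<open>The fall to \<open>D\<close> is worse than \<open>T\<close> for a long
        position, the rise to \<open>U\<close> for a short one.\<close>
      proof (cases "0 \<le> hedge n T")
        case True
        then have "hedge n T * (D (Suc n) - T n) \<le> hedge n T * (T (Suc n) - T n)"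
          using UD by (intro mult_left_mono) auto
        then show ?thesis using nonneg by linarith
      next
        case False
        then have "hedge n T * (U (Suc n) - T n) \<le> hedge n T * (T (Suc n) - T n)"
          using UD by (intro mult_left_mono_neg) auto
        then show ?thesis using nonneg by linarith
      qed
      then show ?thesis using value_Suc[OF self_in_node[OF \<open>T \<in> \<S>\<close>]] by simp
    qed
  qed
qed

text \<open>If \<open>T\<close> makes an arbitrage move, the free bets pay
  \<open>\<infinity>\<close>. Otherwise \<open>T\<close> is live forever, so
  \<open>hedge_value\<close> equals \<open>total\<close>, whose lower limit dominates
  \<open>f T\<close>.\<close>

lemma superhedge_le_suminf:
  assumes "\<And>T. T \<in> node \<S> S j \<Longrightarrow>
    f T \<le> ereal (member 0 n0 T) + (\<Sum>m. limit_portfolio j (V (Suc m)) (H (Suc m)) T)"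
  shows "superhedge \<S> j f S \<le> ereal (suminf V)"
proof -
  \<comment> \<open>Index 0 carries the hedge and all of the capital; every later index repeats the
    free arbitrage bet.\<close>
  define V' where "V' = case_nat (suminf V) (\<lambda>_. 0)"
  define H' where "H' = case_nat hedge (\<lambda>_. arbitrage_strategy \<S>)"
  have nonneg': "nonneg_portfolio \<S> S j (V' m) (H' m)" for m
    using hedge_in_strategies hedge_value_nonneg nonneg_portfolio_arbitrage
    by (auto simp: V'_def H'_def nonneg_portfolio_def split: nat.split)
  have "superhedge \<S> j f S \<le> (\<Sum>m. ereal (V' m))"
  proof (rule superhedge_le[OF nonneg'])
    fix T assume T: "T \<in> node \<S> S j"
    then have "T \<in> \<S>" by (simp add: node_def)
    have lim_nonneg: "0 \<le> limit_portfolio j (V' m) (H' m) T" for m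
      by (rule limit_portfolio_nonneg[OF nonneg' T])
    show "f T \<le> (\<Sum>m. limit_portfolio j (V' m) (H' m) T)"
    proof (cases "\<exists>k\<ge>j. arbitrage_move \<S> T k")
      case True
      then have "\<infinity> = (\<Sum>m::nat. limit_portfolio j 0 (arbitrage_strategy \<S>) T)"
        using suminf_const_pos_ereal limit_portfolio_arbitrage_pos[OF \<open>T \<in> \<S>\<close>] by metis
      also have "\<dots> \<le> (\<Sum>m. limit_portfolio j (V' m) (H' m) T)"
        using suminf_ereal_offset_le[of "\<lambda>m. limit_portfolio j (V' m) (H' m) T" 1] lim_nonneg
        by (simp add: V'_def H'_def)
      finally show ?thesis by simp
    next
      case False
      then have live: "live T n" for n
        using bad_node_arbitrage_move[OF self_in_node[OF \<open>T \<in> \<S>\<close>]]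
        by (fastforce simp: live_def)
      have "f T \<le> liminf (\<lambda>n. ereal (total n T))"
        using assms[OF T] le_liminf_total[OF T, of j] live_summable[OF T _ live] order_trans by blast
      also have "\<dots> = liminf (\<lambda>n. ereal (hedge_value n T))"
        using hedge_value_live[OF T _ live]
        by (intro Liminf_eq eventually_sequentiallyI[of j]) simp
      also have "\<dots> = (\<Sum>m<1. limit_portfolio j (V' m) (H' m) T)"
        by (simp add: V'_def H'_def limit_portfolio_def)
      also have "\<dots> \<le> (\<Sum>m. limit_portfolio j (V' m) (H' m) T)"
        by (rule suminf_upper[OF lim_nonneg])
      finally show ?thesis .
    qed
  qed
  also have "\<dots> = ereal (suminf V)"
    using suminf_split_initial_segment_ereal[of "\<lambda>m. ereal (V' m)" 1]
      nonneg_portfolio_initial[OF nonneg' self_in_node[OF S_in]]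
    by (simp add: V'_def flip: zero_ereal_def)
  finally show ?thesis .
qed

end

section \<open>Property K\<close>

text \<open>Fix any superhedge \<open>V'\<close>, \<open>H'\<close> of the negative part of
  \<open>g\<close>, with limit sum \<open>B\<close>. As \<open>B\<close> dominates both 0 and
  \<open>- g\<close>, the positive part of \<open>g\<close> is at most \<open>g + B\<close>, to
  which the aggregation applies. The infimum over \<open>V'\<close>, \<open>H'\<close> then gives
  the claim.\<close>

lemma property_K_good_node:
  assumes TC: "TC_bad \<S>" and P: "P_bad \<S>" and S: "S \<in> \<S>" and good: "good_node \<S> S j"
  shows "property_K \<S> S j"
proof -
  have "superhedge \<S> j (\<lambda>T. max (g T) 0) S
      \<le> ereal (\<Sum>m=0..n. V m) + superhedge \<S> j (\<lambda>T. max (- g T) 0) S"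
    if H0: "H 0 \<in> strategies \<S> S j"
      and H: "\<forall>m\<in>{1..n}. nonneg_portfolio \<S> S j (V m) (H m)"
      and g: "g = (\<lambda>T. ereal (portfolio j (V 0) (H 0) n0 T)
        + (\<Sum>m=1..n. limit_portfolio j (V m) (H m) T))"
    for n n0 and V :: "nat \<Rightarrow> real" and H g
  proof -
    have "superhedge \<S> j (\<lambda>T. max (g T) 0) S \<le> (\<Sum>m. ereal (V' m)) + ereal (\<Sum>m=0..n. V m)"
      if V'H': "\<forall>m. nonneg_portfolio \<S> S j (V' m) (H' m)"
        and cover: "\<forall>T\<in>node \<S> S j. max (- g T) 0 \<le> (\<Sum>m. limit_portfolio j (V' m) (H' m) T)"
      for V' :: "nat \<Rightarrow> real" and H'
    proof (cases "(\<Sum>m. ereal (V' m)) = \<infinity>")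
      case False
      have V'_nonneg: "0 \<le> V' m" for m
        using nonneg_portfolio_initial[OF _ self_in_node[OF S]] V'H' by blast
      have summable_V': "summable V'"
        using V'_nonneg False by (rule summable_ereal)
      \<comment> \<open>The summands of \<open>g\<close> occupy the indices 0 to \<open>n\<close>,
        the superhedge those from \<open>Suc n\<close> on. \<open>H 0\<close> is cut off at
        \<open>n0\<close> to satisfy \<open>horizon\<close>, which leaves its value at time
        \<open>n0\<close> unchanged.\<close>
      define VV where "VV = (\<lambda>m. if m \<le> n then V m else V' (m - Suc n))"
      define HH where "HH = (\<lambda>m. if m = 0 then \<lambda>i T. if i < n0 then H 0 i T else 0
        else if m \<le> n then H m else H' (m - Suc n))"
      have VV_shift: "VV (m + Suc n) = V' m" for m
        by (simp add: VV_def)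
      have summable_VV: "summable VV"
        using summable_iff_shift[of VV "Suc n"] summable_V' by (simp only: VV_shift)
      have "suminf VV = (\<Sum>m. VV (m + Suc n)) + (\<Sum>m<Suc n. VV m)"
        using summable_VV by (rule suminf_split_initial_segment)
      also have "(\<Sum>m<Suc n. VV m) = (\<Sum>m=0..n. V m)"
        by (rule sum.cong) (auto simp: VV_def)
      finally have suminf_VV: "suminf VV = suminf V' + (\<Sum>m=0..n. V m)"
        by (simp only: VV_shift)
      have nonneg: "nonneg_portfolio \<S> S j (VV (Suc m)) (HH (Suc m))" for m
        using H V'H' by (auto simp: VV_def HH_def)
      have strat: "HH m \<in> strategies \<S> S j" for m
      proof (cases m)
        case 0
        then show ?thesis using strategies_truncate[OF H0] by (simp add: HH_def)
      next
        case (Suc k)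
        then show ?thesis using nonneg[of k] by (simp add: nonneg_portfolio_def)
      qed
      have initial: "portfolio j (VV 0) (HH 0) n0 T = portfolio j (V 0) (H 0) n0 T" for T
        by (simp add: VV_def HH_def portfolio_def)
      have main: "max (g T) 0 \<le> ereal (portfolio j (VV 0) (HH 0) n0 T)
          + (\<Sum>m. limit_portfolio j (VV (Suc m)) (HH (Suc m)) T)" if T: "T \<in> node \<S> S j" for T
      proof -
        define A where "A = (\<Sum>m=1..n. limit_portfolio j (V m) (H m) T)"
        define B where "B = (\<Sum>m. limit_portfolio j (V' m) (H' m) T)"
        have "0 \<le> A"
          unfolding A_def using H limit_portfolio_nonneg[OF _ T] by (intro sum_nonneg) auto
        have "(\<Sum>m. limit_portfolio j (VV (Suc m)) (HH (Suc m)) T)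
            = (\<Sum>m<n. limit_portfolio j (VV (Suc m)) (HH (Suc m)) T)
            + (\<Sum>m. limit_portfolio j (VV (Suc (m + n))) (HH (Suc (m + n))) T)"
          by (rule suminf_split_initial_segment_ereal) (rule limit_portfolio_nonneg[OF nonneg T])
        also have "(\<Sum>m<n. limit_portfolio j (VV (Suc m)) (HH (Suc m)) T) = A"
          unfolding A_def by (rule sum.reindex_bij_witness[of _ "\<lambda>m. m - 1" Suc])
            (auto simp: VV_def HH_def)
        also have "(\<Sum>m. limit_portfolio j (VV (Suc (m + n))) (HH (Suc (m + n))) T) = B"
          by (simp add: B_def VV_def HH_def)
        finally have sum: "(\<Sum>m. limit_portfolio j (VV (Suc m)) (HH (Suc m)) T) = A + B" .
        have gT: "g T = ereal (portfolio j (V 0) (H 0) n0 T) + A"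
          by (simp add: g A_def)
        have "max (- g T) 0 \<le> B"
          using cover T by (simp add: B_def)
        then show ?thesis
          unfolding sum gT initial using \<open>0 \<le> A\<close>
          by (cases A; cases B) (auto simp: max_def split: if_splits)
      qed
      interpret hedge_family \<S> S j n0 VV HH
        using TC P S good strat nonneg summable_VV main
        by unfold_locales (auto simp: HH_def intro: order_trans[OF max.cobounded2])
      have "superhedge \<S> j (\<lambda>T. max (g T) 0) S \<le> ereal (suminf VV)"
        using main by (rule superhedge_le_suminf)
      also have "\<dots> = (\<Sum>m. ereal (V' m)) + ereal (\<Sum>m=0..n. V m)"
        by (simp add: suminf_VV suminf_ereal'[OF summable_V'])
      finally show ?thesis .
    qed simp
    \<comment> \<open>With the finite capital of \<open>g\<close> on the left, the right side is a
      bare infimum and \<open>Inf_greatest\<close> applies.\<close>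
    then have "superhedge \<S> j (\<lambda>T. max (g T) 0) S - ereal (\<Sum>m=0..n. V m)
        \<le> superhedge \<S> j (\<lambda>T. max (- g T) 0) S"
      unfolding superhedge_def[of _ _ "\<lambda>T. max (- g T) 0"]
      by (intro Inf_greatest) (auto simp: ereal_minus_le)
    then show ?thesis by (simp add: ereal_minus_le add.commute)
  qed
  then show ?thesis unfolding property_K_def Let_def by blast
qed

theorem corollary6p13:
  fixes s0 :: real and \<S> :: "trajectory set" and S :: trajectory
  assumes "trajectory_set s0 \<S>"
    and "TC_bad \<S>"
    and "P_bad \<S>"
    and "S \<in> \<S>"
    and "good_node \<S> S 0"
  shows "K_ae \<S>"
proof -
  \<comment> \<open>A trajectory without arbitrage moves meets only good nodes, so one exceptional
    null set serves every \<open>j\<close>.\<close>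
  have "property_K \<S> T j" if "T \<in> \<S> - {T\<in>\<S>. \<exists>k. arbitrage_move \<S> T k}" for T j
    using that bad_node_arbitrage_move[OF self_in_node, of T \<S> j]
    by (intro property_K_good_node assms) auto
  then show ?thesis
    unfolding K_ae_def almost_everywhere_def using null_set_arbitrage_moves by blast
qed

end
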